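(* Let $f:\mathbb{R}^d\to\mathbb{R}$ be convex with $\mathcal{X}^*=\operatorname{argmin}_{x\in\mathbb{R}^d}f(x)\neq\emptyset$ and $f^*=\min_{x\in\mathbb{R}^d} f(x)$. Let $x^0\in\mathbb{R}^d$ and let the iterates $\{x^k\}_{k\ge0}$ be generated by the subgradient method $x^{k+1}=x^k-\alpha_kg(x^k)$ with $g(x^k)\in\partial f(x^k)$ and step sizes $$\alpha_k=\frac{\beta_k}{\|g(x^k)\|}\quad\text{with}\quad \beta_k>0\quad\text{and}\quad\sum_{k=0}^\infty\beta_k^2\le\mathfrak{b}<\infty.$$ Let $\tilde x^k=\frac{\sum_{j=0}^k\beta_jx^j}{\sum_{j=0}^k\beta_j}$ for all $k\ge0$ and fix any $x^*\in\mathcal{X}^*$. Then the trajectory $\{x^k\}$ lies in the ball $\mathcal{C}:=\{x\in\mathbb{R}^d:\|x-x^*\|^2\le\|x^0-x^*\|^2+\mathfrak{b}\}$. Consequently, for any bounded open convex set $\mathcal{C}'$ that contains $\mathcal{C}$, $$f(\tilde x^k)-f^*\le\frac{L_{\mathcal{C}'}\left(\|x^0-x^*\|^2+\mathfrak{b}\right)}{2\sum_{j=0}^k\beta_j},\qquad\forall k\ge0,$$ where $L_{\mathcal{C}'}>0$ is the Lipschitz constant of $f$ on $\mathcal{C}'$. Moreover, if $\beta_k=\frac{c}{\sqrt{k+1}\,\log(k+2)}$ for all $k\ge0$, where $c>0$ is some constant, then $$f(\tilde x^k)-f^*\le\frac{L_{\mathcal{C}'}\left(\frac{\|x^0-x^*\|^2}{2c}+\frac{c}{\log^2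 2}\right)\log(k+2)}{\sqrt{k+1}},\qquad\forall k\ge0.$$
   Context: $\|\cdot\|$ is the Euclidean norm and $\log$ the natural logarithm. For convex $f$, $\partial f(x)=\{g\in\mathbb{R}^d:f(y)\ge f(x)+\langle g,y-x\rangle\ \forall y\in\mathbb{R}^d\}$; $g(x^k)$ is an arbitrarily chosen element of $\partial f(x^k)$. If $g(x^k)=0$, then $x^{k+1}=x^k$ regardless of the value assigned to $\alpha_k$. $f$ is not assumed globally Lipschitz; a finite-valued convex function is automatically Lipschitz on bounded sets, so $L_{\mathcal{C}'}>0$ with $|f(x)-f(y)|\le L_{\mathcal{C}'}\|x-y\|$ on $\mathcal{C}'$ exists. *)

theory Defs
  imports "HOL-Analysis.Analysis"
begin

definition subdifferential :: "(real ^ 'd \<Rightarrow> real) \<Rightarrow> real ^ 'd \<Rightarrow> (real ^ 'd) set" where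
  "subdifferential f x = {g. \<forall>y. f y \<ge> f x + g \<bullet> (y - x)}"

definition minimizers :: "(real ^ 'd \<Rightarrow> real) \<Rightarrow> (real ^ 'd) set" where
  "minimizers f = {x. is_arg_min f (\<lambda>_. True) x}"

text \<open>The minimum of \<open>f\<close>, i.e. the least element of its range; meaningful only
  when \<open>minimizers f \<noteq> {}\<close>.\<close>

definition min_value :: "(real ^ 'd \<Rightarrow> real) \<Rightarrow> real" where
  "min_value f = (LEAST v. v \<in> range f)"

text \<open>The subgradient \<open>g k\<close> is chosen per iteration, so a point visited twice may be
  given different subgradients; a fixed selection \<open>G\<close> is the case \<open>g k = G (x k)\<close>.\<close>

definition subgradient_method ::
  "(real ^ 'd \<Rightarrow> real) \<Rightarrow> (nat \<Rightarrow> real) \<Rightarrow> (nat \<Rightarrow> real ^ 'd) \<Rightarrow> (nat \<Rightarrow> real ^ 'd) \<Rightarrow> bool" where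
  "subgradient_method f \<alpha> g x \<longleftrightarrow>
     (\<forall>k. g k \<in> subdifferential f (x k) \<and> x (Suc k) = x k - \<alpha> k *\<^sub>R g k)"

text \<open>\<open>\<alpha> k\<close> is left arbitrary when \<open>g k = 0\<close>: the iterate then does not move.\<close>

definition normalized_steps ::
  "(nat \<Rightarrow> real) \<Rightarrow> (nat \<Rightarrow> real) \<Rightarrow> (nat \<Rightarrow> real ^ 'd) \<Rightarrow> bool" where
  "normalized_steps \<alpha> \<beta> g \<longleftrightarrow> (\<forall>k. g k \<noteq> 0 \<longrightarrow> \<alpha> k = \<beta> k / norm (g k))"

definition weighted_average :: "(nat \<Rightarrow> real) \<Rightarrow> (nat \<Rightarrow> real ^ 'd) \<Rightarrow> nat \<Rightarrow> real ^ 'd" where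
  "weighted_average \<beta> x k = (\<Sum>j\<le>k. \<beta> j *\<^sub>R x j) /\<^sub>R (\<Sum>j\<le>k. \<beta> j)"

definition trajectory_ball :: "real ^ 'd \<Rightarrow> real ^ 'd \<Rightarrow> real \<Rightarrow> (real ^ 'd) set" where
  "trajectory_ball xstar x0 b = {x. (norm (x - xstar))\<^sup>2 \<le> (norm (x0 - xstar))\<^sup>2 + b}"

end

theory Submission
  imports Defs
begin

text \<open>One step of the method satisfies
  \<open>\<parallel>x\<^sub>k\<^sub>+\<^sub>1 - x\<^sup>*\<parallel>\<^sup>2 = \<parallel>x\<^sub>k - x\<^sup>*\<parallel>\<^sup>2 - 2 \<beta>\<^sub>k \<langle>g\<^sub>k, x\<^sub>k - x\<^sup>*\<rangle> / \<parallel>g\<^sub>k\<parallel> + \<beta>\<^sub>k\<^sup>2\<close>. The inner product is at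
  least \<open>f x\<^sub>k - f\<^sup>* \<ge> 0\<close>, so summation confines the trajectory to the ball; there \<open>\<parallel>g\<^sub>k\<parallel> \<le> L\<close>,
  and summing again gives \<open>2 \<Sum> \<beta>\<^sub>j (f x\<^sub>j - f\<^sup>*) \<le> L (\<parallel>x\<^sub>0 - x\<^sup>*\<parallel>\<^sup>2 + \<Sum> \<beta>\<^sub>j\<^sup>2)\<close>, from which Jensen's
  inequality yields the rate. For the logarithmic weights, \<open>\<Sum> \<beta>\<^sub>j\<^sup>2\<close> is compared with the
  telescoping sum of \<open>1 / ln (j + 1) - 1 / ln (j + 2)\<close>.\<close>

text \<open>Continuity bounds \<open>f\<close> by some \<open>M\<close> on a ball with one unit of
  slack around \<open>S\<close>. By convexity the slope from \<open>x\<close> to \<open>y\<close> is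
  at most the slope over the segment prolonged into the slack, which has length at least 1; hence
  the constant \<open>2 * M\<close>.\<close>

lemma convex_on_UNIV_lipschitz_on_bounded:
  fixes f :: "'a::euclidean_space \<Rightarrow> real"
  assumes f: "convex_on UNIV f" and S: "bounded S"
  shows "\<exists>L>0. L-lipschitz_on S f"
proof -
  obtain R where R: "\<And>x. x \<in> S \<Longrightarrow> norm x \<le> R"
    using S by (auto simp: bounded_iff)
  have "continuous_on (cball 0 (R + 1)) f"
    using convex_on_continuous[OF open_UNIV f] continuous_on_subset by blast
  then have "bounded (f ` cball 0 (R + 1))"
    by (intro compact_imp_bounded compact_continuous_image compact_cball)
  then obtain M where M: "M > 0" "\<And>x. norm x \<le> R + 1 \<Longrightarrow> \<bar>f x\<bar> \<le> M"
    by (auto simp: bounded_pos)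
  have le: "f y - f x \<le> 2 * M * dist x y" if x: "x \<in> S" and y: "y \<in> S" for x y
  proof (cases "x = y")
    case False
    define d where "d = norm (y - x)"
    have d: "d > 0" using False by (simp add: d_def)
    \<comment> \<open>\<open>z\<close> lies one unit beyond \<open>y\<close> on the ray from
      \<open>x\<close>, so \<open>y\<close> divides the segment from \<open>x\<close> to
      \<open>z\<close> in the ratio \<open>d : 1\<close>.\<close>
    define z where "z = y + (1 / d) *\<^sub>R (y - x)"
    have "norm z \<le> norm y + norm ((1 / d) *\<^sub>R (y - x))"
      unfolding z_def by (rule norm_triangle_ineq)
    also have "\<dots> = norm y + 1" using d by (simp add: d_def)
    finally have z: "norm z \<le> R + 1" using R[OF y] by simp
    define t where "t = d / (1 + d)"
    have t: "0 \<le> t" "t \<le> 1" "t \<le> d" using d by (auto simp: t_def field_simps)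
    have "(1 + d) * (1 - t) = 1" "(1 + d) * t = d" using d by (auto simp: t_def field_simps)
    then have "(1 + d) *\<^sub>R ((1 - t) *\<^sub>R x + t *\<^sub>R z) = x + d *\<^sub>R z"
      by (simp add: scaleR_add_right)
    also have "\<dots> = (1 + d) *\<^sub>R y"
      using d by (simp add: z_def algebra_simps)
    finally have "(1 - t) *\<^sub>R x + t *\<^sub>R z = y" using d by simp
    then have "f y \<le> (1 - t) * f x + t * f z"
      using convex_onD[OF f t(1,2), of x z] by simp
    then have "f y - f x \<le> t * (f z - f x)" by (simp add: algebra_simps)
    also have "\<dots> \<le> t * (2 * M)"
      using M(2)[OF z] M(2)[of x] R[OF x] t by (intro mult_left_mono) auto
    also have "\<dots> \<le> d * (2 * M)" using t M by (intro mult_right_mono) auto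
    finally show ?thesis by (simp add: d_def dist_norm norm_minus_commute mult.commute)
  qed simp
  have "(2 * M)-lipschitz_on S f"
  proof (rule lipschitz_onI)
    show "dist (f x) (f y) \<le> 2 * M * dist x y" if "x \<in> S" "y \<in> S" for x y
      using le[OF that] le[OF that(2,1)] by (simp add: dist_real_def abs_le_iff dist_commute)
  qed (use M in simp)
  then show ?thesis using M(1) by (intro exI[of _ "2 * M"]) simp
qed

text \<open>Openness leaves room to move a distance \<open>e\<close> from \<open>x\<close> in the
  direction of \<open>g\<close>. This raises \<open>f\<close> by at least \<open>e * norm g\<close>
  and by at most \<open>L * e\<close>.\<close>

lemma subgradient_norm_le_lipschitz:
  assumes g: "g \<in> subdifferential f x" and L: "L-lipschitz_on S f"
    and S: "open S" and x: "x \<in> S"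
  shows "norm g \<le> L"
proof (cases "g = 0")
  case True
  then show ?thesis using lipschitz_on_nonneg[OF L] by simp
next
  case False
  obtain e where e: "e > 0" "cball x e \<subseteq> S" using S x open_contains_cball by blast
  define t where "t = e / norm g"
  have t: "t > 0" using e False by (simp add: t_def)
  define y where "y = x + t *\<^sub>R g"
  have "y \<in> S" using e False by (auto simp: y_def t_def dist_norm)
  have "t * norm g * norm g \<le> f y - f x"
  proof -
    have "f y \<ge> f x + g \<bullet> (y - x)" using g by (simp add: subdifferential_def)
    then show ?thesis by (simp add: y_def dot_square_norm power2_eq_square mult.assoc)
  qed
  also have "\<dots> \<le> L * dist y x"
    using lipschitz_onD[OF L \<open>y \<in> S\<close> x] by (simp add: dist_real_def)
  also have "\<dots> = t * norm g * L" using t by (simp add: y_def dist_norm)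
  finally show ?thesis using t False by (simp add: mult_le_cancel_left)
qed

lemma min_value_eq:
  assumes "z \<in> minimizers f"
  shows "min_value f = f z" "f z \<le> f y"
proof -
  have le: "f z \<le> f y" for y
    using assms by (auto simp: minimizers_def is_arg_min_def not_less)
  show "f z \<le> f y" by (rule le)
  show "min_value f = f z" unfolding min_value_def
    by (rule Least_equality) (use le in auto)
qed

text \<open>The first bound is free of \<open>L\<close>, so it can confine the trajectory before any
  bound on the subgradients is at hand; the second is then applied inside the ball.\<close>

lemma subgradient_step:
  assumes sm: "subgradient_method f \<alpha> g x" and ns: "normalized_steps \<alpha> \<beta> g"
    and \<beta>: "\<beta> k > 0" and z: "z \<in> minimizers f"
  shows "(norm (x (Suc k) - z))\<^sup>2 \<le> (norm (x k - z))\<^sup>2 + (\<beta> k)\<^sup>2"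
    and "L > 0 \<Longrightarrow> norm (g k) \<le> L \<Longrightarrow>
      2 * \<beta> k * (f (x k) - f z) \<le> L * ((norm (x k - z))\<^sup>2 - (norm (x (Suc k) - z))\<^sup>2 + (\<beta> k)\<^sup>2)"
proof -
  define \<delta> where "\<delta> = f (x k) - f z"
  define p where "p = g k \<bullet> (x k - z)"
  have \<delta>0: "\<delta> \<ge> 0" using min_value_eq(2)[OF z, of "x k"] by (simp add: \<delta>_def)
  have "g k \<in> subdifferential f (x k)" and step: "x (Suc k) = x k - \<alpha> k *\<^sub>R g k"
    using sm by (auto simp: subgradient_method_def)
  then have "f z \<ge> f (x k) + g k \<bullet> (z - x k)" by (simp add: subdifferential_def)
  then have p: "\<delta> \<le> p" by (simp add: \<delta>_def p_def inner_diff_right)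
  have "(norm (x (Suc k) - z))\<^sup>2 \<le> (norm (x k - z))\<^sup>2 + (\<beta> k)\<^sup>2 \<and>
    (L > 0 \<longrightarrow> norm (g k) \<le> L \<longrightarrow>
      2 * \<beta> k * \<delta> \<le> L * ((norm (x k - z))\<^sup>2 - (norm (x (Suc k) - z))\<^sup>2 + (\<beta> k)\<^sup>2))" for L
  proof (cases "g k = 0")
    case True
    \<comment> \<open>A zero subgradient makes \<open>x k\<close> a minimizer and the iterate stays
      put, so both bounds hold whatever the value of \<open>\<alpha> k\<close>.\<close>
    then have "\<delta> = 0" using p \<delta>0 by (simp add: p_def)
    then show ?thesis using step True by simp
  next
    case False
    then have \<alpha>: "\<alpha> k = \<beta> k / norm (g k)" using ns by (simp add: normalized_steps_def)
    have "(norm (x (Suc k) - z))\<^sup>2 = (norm (x k - z))\<^sup>2 - 2 * \<alpha> k * p + (\<alpha> k * norm (g k))\<^sup>2"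
      unfolding p_def power_mult_distrib power2_norm_eq_inner step
      by (simp add: inner_diff inner_commute power2_eq_square algebra_simps)
    then have eq: "(norm (x k - z))\<^sup>2 - (norm (x (Suc k) - z))\<^sup>2 + (\<beta> k)\<^sup>2 = 2 * \<beta> k * (p / norm (g k))"
      using False \<alpha> by simp
    have "p / norm (g k) \<ge> 0" using p \<delta>0 by simp
    then have "2 * \<beta> k * (p / norm (g k)) \<ge> 0" using \<beta> by (intro mult_nonneg_nonneg) auto
    then have "(norm (x (Suc k) - z))\<^sup>2 \<le> (norm (x k - z))\<^sup>2 + (\<beta> k)\<^sup>2" using eq by linarith
    moreover have "2 * \<beta> k * \<delta> \<le> L * (2 * \<beta> k * (p / norm (g k)))"
      if L: "L > 0" "norm (g k) \<le> L"
    proof -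
      have "\<delta> * norm (g k) \<le> p * L" using p \<delta>0 L by (intro mult_mono) auto
      then have "\<delta> \<le> L * (p / norm (g k))" using False by (simp add: field_simps)
      then have "2 * \<beta> k * \<delta> \<le> 2 * \<beta> k * (L * (p / norm (g k)))"
        using \<beta> by (intro mult_left_mono) auto
      then show ?thesis by (simp add: mult_ac)
    qed
    ultimately show ?thesis using eq by metis
  qed
  then show "(norm (x (Suc k) - z))\<^sup>2 \<le> (norm (x k - z))\<^sup>2 + (\<beta> k)\<^sup>2"
    and "L > 0 \<Longrightarrow> norm (g k) \<le> L \<Longrightarrow>
      2 * \<beta> k * (f (x k) - f z) \<le> L * ((norm (x k - z))\<^sup>2 - (norm (x (Suc k) - z))\<^sup>2 + (\<beta> k)\<^sup>2)"
    by (auto simp: \<delta>_def)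
qed

text \<open>Jensen's inequality with the normalized weights \<open>\<beta> j / S\<close>, multiplied
  through by \<open>S\<close>.\<close>

lemma weighted_average_gap_le:
  assumes f: "convex_on UNIV f" and \<beta>: "\<And>k. \<beta> k > 0"
  shows "(\<Sum>j\<le>k. \<beta> j) * (f (weighted_average \<beta> x k) - v) \<le> (\<Sum>j\<le>k. \<beta> j * (f (x j) - v))"
proof -
  define S where "S = (\<Sum>j\<le>k. \<beta> j)"
  have S: "S > 0" unfolding S_def using \<beta> by (intro sum_pos) auto
  have "weighted_average \<beta> x k = (\<Sum>j\<le>k. (\<beta> j / S) *\<^sub>R x j)"
    unfolding weighted_average_def S_def[symmetric]
    by (simp add: scaleR_sum_right divide_inverse_commute)
  moreover have "f (\<Sum>j\<le>k. (\<beta> j / S) *\<^sub>R x j) \<le> (\<Sum>j\<le>k. (\<beta> j / S) * f (x j))"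
    using S \<beta> by (intro convex_on_sum[OF _ _ f])
      (auto simp: less_imp_le simp flip: sum_divide_distrib S_def)
  ultimately have "f (weighted_average \<beta> x k) \<le> (\<Sum>j\<le>k. \<beta> j * f (x j)) / S"
    by (simp add: sum_divide_distrib)
  then have "S * f (weighted_average \<beta> x k) \<le> (\<Sum>j\<le>k. \<beta> j * f (x j))"
    using S by (simp add: field_simps)
  then show ?thesis
    by (simp add: right_diff_distrib sum_subtractf S_def flip: sum_distrib_right)
qed

text \<open>The correction term \<open>3 / (2 * ln (k + 3))\<close> makes the induction go through; the analogous
  bound fails for the one-term sum, hence the upper limit \<open>Suc k\<close>.\<close>

lemma sum_inverse_mult_ln_squared_Suc_le:
  "(\<Sum>j\<le>Suc k. 1 / (real (j + 1) * (ln (real j + 2))\<^sup>2)) \<le> 2 / (ln 2)\<^sup>2 - 3 / (2 * ln (real k + 3))"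
proof (induction k)
  case 0
  define a where "a = ln (2::real)"
  have a: "0 < a" "a \<le> 25/36" using ln2_le_25_over_36 by (auto simp: a_def)
  \<comment> \<open>\<open>8 \<le> 9\<close> gives \<open>ln 3 \<ge> 3 / 2 * ln 2\<close>. The claim
    leaves a budget of \<open>1 / a\<^sup>2\<close>, split below as \<open>2 / 9 + 7 / 9\<close>;
    the second share needs \<open>a \<le> 7 / 9\<close>, which follows from
    \<open>25 / 36 < 28 / 36\<close>.\<close>
  have "3 * a = ln (2 ^ 3)" unfolding a_def by (subst ln_realpow) auto
  also have "\<dots> \<le> ln (3 ^ 2)" by (subst ln_le_cancel_iff) auto
  also have "\<dots> = 2 * ln 3" by (subst ln_realpow) auto
  finally have l3: "3 / 2 * a \<le> ln 3" by simp
  have "1 / (2 * (ln 3)\<^sup>2) \<le> 1 / (2 * (3 / 2 * a)\<^sup>2)"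
    using l3 a by (intro divide_left_mono mult_left_mono power_mono) auto
  also have "\<dots> = (2 / 9) / a\<^sup>2" by (simp add: power2_eq_square)
  finally have 1: "1 / (2 * (ln 3)\<^sup>2) \<le> (2 / 9) / a\<^sup>2" .
  have "3 / (2 * ln 3) \<le> 3 / (2 * (3 / 2 * a))"
    using l3 a by (intro divide_left_mono) auto
  also have "\<dots> = a / a\<^sup>2" by (simp add: power2_eq_square)
  also have "\<dots> \<le> (7 / 9) / a\<^sup>2" using a by (intro divide_right_mono) auto
  finally have 2: "3 / (2 * ln 3) \<le> (7 / 9) / a\<^sup>2" .
  have "1 / (2 * (ln 3)\<^sup>2) + 3 / (2 * ln 3) \<le> (2 / 9) / a\<^sup>2 + (7 / 9) / a\<^sup>2" using 1 2 by linarith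
  also have "\<dots> = 1 / a\<^sup>2" by (simp flip: add_divide_distrib)
  finally show ?case by (simp add: a_def)
next
  case (Suc k)
  define n where "n = real k + 3"
  define p q where "p = ln n" and "q = ln (n + 1)"
  have n: "n \<ge> 3" by (simp add: n_def)
  have p: "0 < p" "p \<le> q" using n by (auto simp: p_def q_def)
  have "1 / (n + 1) \<le> q - p"
    using ln_diff_le[of n "n + 1"] n by (simp add: p_def q_def field_simps)
  have "1 / (n * q\<^sup>2) = 1 / n / (q * q)" by (simp add: power2_eq_square)
  \<comment> \<open>The factor \<open>3 / 2\<close> pays for passing from \<open>1 / n\<close> to
    \<open>1 / (n + 1)\<close>, the lower bound for \<open>q - p\<close>. Replacing one
    \<open>q\<close> by \<open>p\<close> afterwards yields
    \<open>(q - p) / (p * q) = 1 / p - 1 / q\<close>, which telescopes.\<close>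
  also have "\<dots> \<le> (3 / 2 * (1 / (n + 1))) / (q * q)"
    using n by (intro divide_right_mono) (auto simp: field_simps)
  also have "\<dots> \<le> (3 / 2 * (q - p)) / (q * q)"
    using p \<open>1 / (n + 1) \<le> q - p\<close> by (intro divide_right_mono mult_left_mono) auto
  also have "\<dots> \<le> (3 / 2 * (q - p)) / (p * q)"
    using p by (intro divide_left_mono mult_right_mono) auto
  also have "\<dots> = 3 / (2 * p) - 3 / (2 * q)" using p by (simp add: field_simps)
  finally have "1 / (n * q\<^sup>2) \<le> 3 / (2 * p) - 3 / (2 * q)" .
  moreover have eqs: "real (Suc (Suc k) + 1) = n" "real (Suc (Suc k)) + 2 = n + 1" "real (Suc k) + 3 = n + 1"
    by (auto simp: n_def)
  ultimately show ?case
    using Suc.IH unfolding sum.atMost_Suc[of _ "Suc k"] eqs p_def q_def n_def[symmetric] by linarith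
qed

lemma sum_inverse_mult_ln_squared_le:
  "(\<Sum>j\<le>k. 1 / (real (j + 1) * (ln (real j + 2))\<^sup>2)) \<le> 2 / (ln 2)\<^sup>2"
proof -
  have "(\<Sum>j\<le>k. 1 / (real (j + 1) * (ln (real j + 2))\<^sup>2))
      \<le> (\<Sum>j\<le>Suc k. 1 / (real (j + 1) * (ln (real j + 2))\<^sup>2))"
    by (intro sum_mono2) auto
  also have "\<dots> \<le> 2 / (ln 2)\<^sup>2 - 3 / (2 * ln (real k + 3))"
    by (rule sum_inverse_mult_ln_squared_Suc_le)
  also have "\<dots> \<le> 2 / (ln 2)\<^sup>2" by simp
  finally show ?thesis .
qed

text \<open>The second bound holds because the weights decrease, so their sum is at least
  \<open>(k + 1) * \<beta> k\<close>. In the first, division by \<open>2 * c\<close> later turns the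
  constant into the \<open>c / (ln 2)\<^sup>2\<close> of the rate.\<close>

lemma log_weights_bounds:
  assumes c: "c > 0" and \<beta>: "\<And>k. \<beta> k = c / (sqrt (real k + 1) * ln (real k + 2))"
  shows "(\<Sum>j\<le>k. (\<beta> j)\<^sup>2) \<le> 2 * c\<^sup>2 / (ln 2)\<^sup>2"
    and "c * sqrt (real k + 1) / ln (real k + 2) \<le> (\<Sum>j\<le>k. \<beta> j)"
proof -
  have "(\<Sum>j\<le>k. (\<beta> j)\<^sup>2) = c\<^sup>2 * (\<Sum>j\<le>k. 1 / (real (j + 1) * (ln (real j + 2))\<^sup>2))"
    by (simp add: \<beta> sum_distrib_left power_divide power_mult_distrib add.commute)
  also have "\<dots> \<le> c\<^sup>2 * (2 / (ln 2)\<^sup>2)"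
    by (intro mult_left_mono sum_inverse_mult_ln_squared_le) auto
  finally show "(\<Sum>j\<le>k. (\<beta> j)\<^sup>2) \<le> 2 * c\<^sup>2 / (ln 2)\<^sup>2" by (simp add: mult.commute)
  have "\<beta> k \<le> \<beta> j" if "j \<le> k" for j
    unfolding \<beta> using c that by (intro divide_left_mono mult_mono) auto
  then have "real (card {..k}) * \<beta> k \<le> (\<Sum>j\<le>k. \<beta> j)"
    by (intro sum_bounded_below) auto
  moreover have "real (card {..k}) * \<beta> k = c * ((real k + 1) / sqrt (real k + 1)) / ln (real k + 2)"
    by (simp add: \<beta> add.commute)
  ultimately show "c * sqrt (real k + 1) / ln (real k + 2) \<le> (\<Sum>j\<le>k. \<beta> j)"
    by (simp add: real_div_sqrt)
qed

theorem corollary1: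
  fixes f :: "real ^ 'd \<Rightarrow> real"
    and x g :: "nat \<Rightarrow> real ^ 'd"
    and \<alpha> \<beta> :: "nat \<Rightarrow> real"
    and b :: real
    and xstar :: "real ^ 'd"
  assumes "convex_on UNIV f"
    and "minimizers f \<noteq> {}"
    and "subgradient_method f \<alpha> g x"
    and "normalized_steps \<alpha> \<beta> g"
    and "\<And>k. \<beta> k > 0"
    and "summable (\<lambda>k. (\<beta> k)\<^sup>2)"
    and "(\<Sum>k. (\<beta> k)\<^sup>2) \<le> b"
    and "xstar \<in> minimizers f"
  shows "(\<forall>k. x k \<in> trajectory_ball xstar (x 0) b) \<and>
    (\<forall>C'. bounded C' \<and> open C' \<and> convex C' \<and> trajectory_ball xstar (x 0) b \<subseteq> C' \<longrightarrow>
      (\<exists>L>0. L-lipschitz_on C' f) \<and>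
      (\<forall>L>0. L-lipschitz_on C' f \<longrightarrow>
        (\<forall>k. f (weighted_average \<beta> x k) - min_value f
               \<le> L * ((norm (x 0 - xstar))\<^sup>2 + b) / (2 * (\<Sum>j\<le>k. \<beta> j))) \<and>
        (\<forall>c>0. (\<forall>k. \<beta> k = c / (sqrt (real k + 1) * ln (real k + 2))) \<longrightarrow>
          (\<forall>k. f (weighted_average \<beta> x k) - min_value f
                 \<le> L * ((norm (x 0 - xstar))\<^sup>2 / (2 * c) + c / (ln 2)\<^sup>2) * ln (real k + 2)
                    / sqrt (real k + 1)))))"
proof -
  let ?D = "\<lambda>k. (norm (x k - xstar))\<^sup>2"
  note convex = assms(1) and iter = assms(3) and steps = assms(4) and \<beta> = assms(5)
    and xstar = assms(8)
  have partial: "(\<Sum>j<k. (\<beta> j)\<^sup>2) \<le> b" for k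
    using sum_le_suminf[OF assms(6), of "{..<k}"] assms(7) by simp
  have "?D k \<le> ?D 0 + (\<Sum>j<k. (\<beta> j)\<^sup>2)" for k
  proof (induction k)
    case (Suc k)
    then show ?case using subgradient_step(1)[where k = k, OF iter steps \<beta> xstar] by simp
  qed simp
  then have "?D k \<le> ?D 0 + b" for k
    using partial by (meson add_left_mono order_trans)
  then have ball: "x k \<in> trajectory_ball xstar (x 0) b" for k
    by (simp add: trajectory_ball_def)
  \<comment> \<open>Both rates are instances: \<open>B = b\<close> with \<open>S\<close> the full
    weight sum, and \<open>B\<close>, \<open>S\<close> taken from \<open>log_weights_bounds\<close>.
    In either case \<open>b\<close> still fixes the ball, whereas \<open>B\<close> only bounds the
    partial sum up to \<open>k\<close>.\<close>
  have gap: "f (weighted_average \<beta> x k) - min_value f \<le> L * (?D 0 + B) / (2 * S)"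
    if C': "open C'" "trajectory_ball xstar (x 0) b \<subseteq> C'" and L: "L > 0" "L-lipschitz_on C' f"
      and B: "(\<Sum>j\<le>k. (\<beta> j)\<^sup>2) \<le> B" and S: "S > 0" "S \<le> (\<Sum>j\<le>k. \<beta> j)" for C' L k B S
  proof -
    have step: "2 * \<beta> j * (f (x j) - f xstar) \<le> L * (?D j - ?D (Suc j) + (\<beta> j)\<^sup>2)" for j
    proof (rule subgradient_step(2)[OF iter steps \<beta> xstar L(1)])
      have "g j \<in> subdifferential f (x j)" using iter by (simp add: subgradient_method_def)
      then show "norm (g j) \<le> L"
        using subgradient_norm_le_lipschitz L(2) C' ball by blast
    qed
    have "2 * (\<Sum>j\<le>k. \<beta> j * (f (x j) - f xstar)) \<le> (\<Sum>j\<le>k. L * (?D j - ?D (Suc j) + (\<beta> j)\<^sup>2))"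
      unfolding sum_distrib_left using step by (intro sum_mono) (simp add: mult.assoc)
    also have "\<dots> = L * (?D 0 - ?D (Suc k) + (\<Sum>j\<le>k. (\<beta> j)\<^sup>2))"
      by (simp add: sum.distrib sum_telescope[of ?D] flip: sum_distrib_left)
    also have "\<dots> \<le> L * (?D 0 + B)"
    proof (rule mult_left_mono)
      have "?D (Suc k) \<ge> 0" by simp
      then show "?D 0 - ?D (Suc k) + (\<Sum>j\<le>k. (\<beta> j)\<^sup>2) \<le> ?D 0 + B" using B by linarith
    qed (use L in simp)
    finally have sum: "2 * (\<Sum>j\<le>k. \<beta> j * (f (x j) - f xstar)) \<le> L * (?D 0 + B)" .
    let ?w = "f (weighted_average \<beta> x k) - f xstar"
    \<comment> \<open>Lowering the total weight to \<open>S\<close> is sound since \<open>?w\<close>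
      is nonnegative by minimality of \<open>xstar\<close>.\<close>
    have "S * ?w \<le> (\<Sum>j\<le>k. \<beta> j) * ?w"
      using S min_value_eq(2)[OF xstar] by (intro mult_right_mono) auto
    also have "\<dots> \<le> (\<Sum>j\<le>k. \<beta> j * (f (x j) - f xstar))"
      by (rule weighted_average_gap_le[OF convex \<beta>])
    finally have "2 * (S * ?w) \<le> L * (?D 0 + B)" using sum by linarith
    then show ?thesis using S(1) min_value_eq(1)[OF xstar] by (simp add: field_simps)
  qed
  have "f (weighted_average \<beta> x k) - min_value f \<le> L * (?D 0 + b) / (2 * (\<Sum>j\<le>k. \<beta> j))"
    if "open C'" "trajectory_ball xstar (x 0) b \<subseteq> C'" "L > 0" "L-lipschitz_on C' f" for C' L k
    \<comment> \<open>\<open>partial\<close> sums over \<open>j < k\<close>, so the sum over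
      \<open>j \<le> k\<close> is its instance at \<open>Suc k\<close>.\<close>
    using that partial[of "Suc k"] \<beta> by (intro gap) (auto simp: lessThan_Suc_atMost intro: sum_pos)
  moreover have "f (weighted_average \<beta> x k) - min_value f
      \<le> L * (?D 0 / (2 * c) + c / (ln 2)\<^sup>2) * ln (real k + 2) / sqrt (real k + 1)"
    if C': "open C'" "trajectory_ball xstar (x 0) b \<subseteq> C'" "L > 0" "L-lipschitz_on C' f"
      and c: "c > 0" "\<forall>k. \<beta> k = c / (sqrt (real k + 1) * ln (real k + 2))" for C' L c k
  proof -
    have eq: "\<beta> j = c / (sqrt (real j + 1) * ln (real j + 2))" for j using c(2) by blast
    have "f (weighted_average \<beta> x k) - min_value f
      \<le> L * (?D 0 + 2 * c\<^sup>2 / (ln 2)\<^sup>2) / (2 * (c * sqrt (real k + 1) / ln (real k + 2)))"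
      using c(1) log_weights_bounds[OF c(1) eq] by (intro gap[OF C']) auto
    also have "\<dots> = L * ((?D 0 + 2 * c\<^sup>2 / (ln 2)\<^sup>2) / (2 * c)) * ln (real k + 2) / sqrt (real k + 1)"
      by simp
    also have "(?D 0 + 2 * c\<^sup>2 / (ln 2)\<^sup>2) / (2 * c) = ?D 0 / (2 * c) + c / (ln 2)\<^sup>2"
      using c(1) by (simp add: add_divide_distrib power2_eq_square)
    finally show ?thesis .
  qed
  ultimately show ?thesis
    by (intro conjI allI impI ball convex_on_UNIV_lipschitz_on_bounded[OF convex]) auto
qed

end
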